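(* Any YBE solution $R$ on a set $X$ induces a regular affine action $\rho^X$ of the structure group $G_X$ on the derived structure group $A_X$. (The action $\rho^X$ is called the affine action associated to $R$.)
   Context: A YBE solution on a non-empty set $X$ is a bijection $R:X^2\to X^2$, written $R(x,y)=(\alpha_x(y),\beta_y(x))$, satisfying $(R\times\mathrm{id})(\mathrm{id}\times R)(R\times\mathrm{id})=(\mathrm{id}\times R)(R\times\mathrm{id})(\mathrm{id}\times R)$ on $X^3$, and non-degenerate, i.e. all $\alpha_x,\beta_x$ ($x\in X$) are bijections of $X$. The structure group $G_X$ is the group generated by $X$ with relations $xy=\alpha_x(y)\beta_y(x)$ ($x,y\in X$). The derived structure group $A_X$ (product written $\bullet$) is the group generated by $X$ with relations $x\bullet y=y\bullet\alpha_y(\beta_{\alpha_x^{-1}(y)}(x))$ ($x,y\in X$). For a group $A$, $\mathrm{Aff}(A)=\mathrm{Aut}(A)\ltimes A$ with $(S,a)(T,b)=(ST,aS(b))$, acting on $A$ by $(S,a)b=aS(b)$. An affine action of a group $G$ on $A$ is a group homomorphism $G\to\mathrm{Aff}(A)$. It is regular if the resulting action on the set $A$ is transitive and free. *)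

theory Defs
  imports "HOL-Algebra.Bij" "HOL-Algebra.Group_Action"
begin

section \<open>Groups given by generators and relations\<close>

text \<open>
  A word is a list of letters \<open>(b, x)\<close>, where \<open>(True, x)\<close> stands for the generator \<open>x\<close> and
  \<open>(False, x)\<close> for its formal inverse.  A relation \<open>l = r\<close> is a pair \<open>(l, r)\<close> of words;
  pairs that are not words over the generating set are ignored.
\<close>

type_synonym 'a word = "(bool \<times> 'a) list"

definition words :: "'a set \<Rightarrow> 'a word set" where
  "words X = lists (UNIV \<times> X)"

inductive_set pres_rel :: "'a set \<Rightarrow> ('a word \<times> 'a word) set \<Rightarrow> ('a word \<times> 'a word) set"
  for X :: "'a set" and Rel :: "('a word \<times> 'a word) set" where
  refl: "w \<in> words X \<Longrightarrow> (w, w) \<in> pres_rel X Rel"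
| sym: "(u, v) \<in> pres_rel X Rel \<Longrightarrow> (v, u) \<in> pres_rel X Rel"
| trans: "(u, v) \<in> pres_rel X Rel \<Longrightarrow> (v, w) \<in> pres_rel X Rel \<Longrightarrow> (u, w) \<in> pres_rel X Rel"
| cancel: "u \<in> words X \<Longrightarrow> v \<in> words X \<Longrightarrow> x \<in> X \<Longrightarrow>
    (u @ [(b, x), (\<not> b, x)] @ v, u @ v) \<in> pres_rel X Rel"
| relation: "(l, r) \<in> Rel \<Longrightarrow> l \<in> words X \<Longrightarrow> r \<in> words X \<Longrightarrow> u \<in> words X \<Longrightarrow> v \<in> words X \<Longrightarrow>
    (u @ l @ v, u @ r @ v) \<in> pres_rel X Rel"

definition presented_group :: "'a set \<Rightarrow> ('a word \<times> 'a word) set \<Rightarrow> 'a word set monoid" where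
  "presented_group X Rel =
    \<lparr>carrier = words X // pres_rel X Rel,
     mult = \<lambda>A B. \<Union>a\<in>A. \<Union>b\<in>B. pres_rel X Rel `` {a @ b},
     one = pres_rel X Rel `` {[]}\<rparr>"

definition generator :: "'a set \<Rightarrow> ('a word \<times> 'a word) set \<Rightarrow> 'a \<Rightarrow> 'a word set" where
  "generator X Rel x = pres_rel X Rel `` {[(True, x)]}"


section \<open>Solutions of the Yang-Baxter equation and their structure groups\<close>

text \<open>The notation is \<open>R (x, y) = (alpha R x y, beta R y x)\<close>.\<close>

definition alpha :: "('a \<times> 'a \<Rightarrow> 'a \<times> 'a) \<Rightarrow> 'a \<Rightarrow> 'a \<Rightarrow> 'a" where
  "alpha R x y = fst (R (x, y))"

definition beta :: "('a \<times> 'a \<Rightarrow> 'a \<times> 'a) \<Rightarrow> 'a \<Rightarrow> 'a \<Rightarrow> 'a" where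
  "beta R y x = snd (R (x, y))"

definition R_times_id :: "('a \<times> 'a \<Rightarrow> 'a \<times> 'a) \<Rightarrow> 'a \<times> 'a \<times> 'a \<Rightarrow> 'a \<times> 'a \<times> 'a" where
  "R_times_id R = (\<lambda>(x, y, z). (case R (x, y) of (x', y') \<Rightarrow> (x', y', z)))"

definition id_times_R :: "('a \<times> 'a \<Rightarrow> 'a \<times> 'a) \<Rightarrow> 'a \<times> 'a \<times> 'a \<Rightarrow> 'a \<times> 'a \<times> 'a" where
  "id_times_R R = (\<lambda>(x, y, z). (x, R (y, z)))"

definition YBE_solution :: "'a set \<Rightarrow> ('a \<times> 'a \<Rightarrow> 'a \<times> 'a) \<Rightarrow> bool" where
  "YBE_solution X R \<longleftrightarrow>
    X \<noteq> {} \<and>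
    bij_betw R (X \<times> X) (X \<times> X) \<and>
    (\<forall>t \<in> X \<times> X \<times> X.
      (R_times_id R \<circ> id_times_R R \<circ> R_times_id R) t =
      (id_times_R R \<circ> R_times_id R \<circ> id_times_R R) t) \<and>
    (\<forall>x\<in>X. bij_betw (alpha R x) X X \<and> bij_betw (beta R x) X X)"

definition structure_relations ::
    "'a set \<Rightarrow> ('a \<times> 'a \<Rightarrow> 'a \<times> 'a) \<Rightarrow> ('a word \<times> 'a word) set" where
  "structure_relations X R =
    {([(True, x), (True, y)], [(True, alpha R x y), (True, beta R y x)]) | x y. x \<in> X \<and> y \<in> X}"

definition derived_relations ::
    "'a set \<Rightarrow> ('a \<times> 'a \<Rightarrow> 'a \<times> 'a) \<Rightarrow> ('a word \<times> 'a word) set" where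
  "derived_relations X R =
    {([(True, x), (True, y)],
      [(True, y), (True, alpha R y (beta R (inv_into X (alpha R x) y) x))]) | x y. x \<in> X \<and> y \<in> X}"

definition structure_group :: "'a set \<Rightarrow> ('a \<times> 'a \<Rightarrow> 'a \<times> 'a) \<Rightarrow> 'a word set monoid" where
  "structure_group X R = presented_group X (structure_relations X R)"

definition structure_gen :: "'a set \<Rightarrow> ('a \<times> 'a \<Rightarrow> 'a \<times> 'a) \<Rightarrow> 'a \<Rightarrow> 'a word set" where
  "structure_gen X R = generator X (structure_relations X R)"

definition derived_structure_group :: "'a set \<Rightarrow> ('a \<times> 'a \<Rightarrow> 'a \<times> 'a) \<Rightarrow> 'a word set monoid" where
  "derived_structure_group X R = presented_group X (derived_relations X R)"

definition derived_gen :: "'a set \<Rightarrow> ('a \<times> 'a \<Rightarrow> 'a \<times> 'a) \<Rightarrow> 'a \<Rightarrow> 'a word set" where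
  "derived_gen X R = generator X (derived_relations X R)"


section \<open>Regular affine actions\<close>

definition Aff :: "('a, 'c) monoid_scheme \<Rightarrow> (('a \<Rightarrow> 'a) \<times> 'a) monoid" where
  "Aff A =
    \<lparr>carrier = carrier (AutoGroup A) \<times> carrier A,
     mult = \<lambda>(S, a) (T, b). (S \<otimes>\<^bsub>AutoGroup A\<^esub> T, a \<otimes>\<^bsub>A\<^esub> S b),
     one = (\<one>\<^bsub>AutoGroup A\<^esub>, \<one>\<^bsub>A\<^esub>)\<rparr>"

text \<open>
  The permutation \<open>b \<mapsto> a S(b)\<close> of \<open>A\<close>, restricted to the carrier as the elements of
  \<^const>\<open>BijGroup\<close> have to be extensional.
\<close>

definition aff_apply :: "('a, 'c) monoid_scheme \<Rightarrow> ('a \<Rightarrow> 'a) \<times> 'a \<Rightarrow> 'a \<Rightarrow> 'a" where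
  "aff_apply A = (\<lambda>(S, a). \<lambda>b\<in>carrier A. a \<otimes>\<^bsub>A\<^esub> S b)"

definition affine_action ::
    "('g, 'c) monoid_scheme \<Rightarrow> ('a, 'd) monoid_scheme \<Rightarrow> ('g \<Rightarrow> ('a \<Rightarrow> 'a) \<times> 'a) \<Rightarrow> bool" where
  "affine_action G A \<rho> \<longleftrightarrow> group A \<and> group_hom G (Aff A) \<rho>"

definition regular_affine_action ::
    "('g, 'c) monoid_scheme \<Rightarrow> ('a, 'd) monoid_scheme \<Rightarrow> ('g \<Rightarrow> ('a \<Rightarrow> 'a) \<times> 'a) \<Rightarrow> bool" where
  "regular_affine_action G A \<rho> \<longleftrightarrow>
    affine_action G A \<rho> \<and>
    transitive_action G (carrier A) (\<lambda>g. aff_apply A (\<rho> g)) \<and>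
    (\<forall>a\<in>carrier A. stabilizer G (\<lambda>g. aff_apply A (\<rho> g)) a = {\<one>\<^bsub>G\<^esub>})"

text \<open>
  The action associated to \<open>R\<close>: each generator \<open>x\<close> of the structure group is sent to \<open>(S, x)\<close>,
  where \<open>S\<close> is the automorphism of the derived structure group with \<open>S y = alpha R x y\<close> on
  generators.  As the generators generate both groups, there is at most one such \<open>\<rho>\<close> on the
  carrier of the structure group.
\<close>

definition associated_affine_action ::
    "'a set \<Rightarrow> ('a \<times> 'a \<Rightarrow> 'a \<times> 'a) \<Rightarrow>
      ('a word set \<Rightarrow> ('a word set \<Rightarrow> 'a word set) \<times> 'a word set) \<Rightarrow> bool" where
  "associated_affine_action X R \<rho> \<longleftrightarrow>
    affine_action (structure_group X R) (derived_structure_group X R) \<rho> \<and>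
    (\<forall>x\<in>X. snd (\<rho> (structure_gen X R x)) = derived_gen X R x \<and>
      (\<forall>y\<in>X. fst (\<rho> (structure_gen X R x)) (derived_gen X R y) = derived_gen X R (alpha R x y)))"

end

theory Submission
  imports Defs
begin

text \<open>
  Writing \<open>R (x, z) = (u, v)\<close>, the relations of \<open>A\<^sub>X\<close> say \<open>x \<bullet> \<alpha> x z = u \<bullet> \<alpha> u v\<close>.  By the braid
  identities each \<open>\<alpha> w\<close> permutes these relations, hence extends to an automorphism \<open>L w\<close> of \<open>A\<^sub>X\<close>,
  and \<open>x \<mapsto> (L x, x)\<close> respects the relations of \<open>G\<^sub>X\<close>.  Regularity of the resulting action means
  that the cocycle \<open>\<pi> : G\<^sub>X \<rightarrow> A\<^sub>X\<close>, its translation part, is bijective.  To invert \<open>\<pi>\<close>, right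
  multiplication by \<open>x\<close> on \<open>A\<^sub>X\<close> is lifted along \<open>\<pi>\<close> to the map \<open>g \<mapsto> g (g\<inverse> \<cdot> x)\<close> of \<open>G\<^sub>X\<close>, where
  \<open>G\<^sub>X\<close> acts on \<open>X\<close> through \<open>\<alpha>\<close>.  This map is a permutation since the diagonal map
  \<open>y \<mapsto> (\<alpha> y)\<inverse> y\<close> of \<open>X\<close> is bijective, which follows from the braid identities.  The lifts
  satisfy the relations of \<open>A\<^sub>X\<close>, and the orbit map of \<open>1\<close> under them is the inverse of \<open>\<pi>\<close>.
\<close>

section \<open>Presented groups\<close>

lemma words_Nil [simp]: "[] \<in> words X"
  by (simp add: words_def)

lemma words_Cons [simp]: "(b, x) # w \<in> words X \<longleftrightarrow> x \<in> X \<and> w \<in> words X"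
  by (auto simp: words_def)

lemma words_append [simp]: "u @ v \<in> words X \<longleftrightarrow> u \<in> words X \<and> v \<in> words X"
  by (auto simp: words_def)

lemma pres_rel_words: "(u, v) \<in> pres_rel X Rel \<Longrightarrow> u \<in> words X \<and> v \<in> words X"
  by (induction rule: pres_rel.induct) auto

lemma equiv_pres_rel: "equiv (words X) (pres_rel X Rel)"
proof (rule equivI)
  show "pres_rel X Rel \<subseteq> words X \<times> words X"
    by (auto dest: pres_rel_words)
  show "refl_on (words X) (pres_rel X Rel)"
    by (auto simp: refl_on_def intro: pres_rel.refl)
  show "sym (pres_rel X Rel)"
    by (auto intro: symI pres_rel.sym)
  show "trans (pres_rel X Rel)"
    by (auto intro: transI pres_rel.trans)
qed

text \<open>The rules \<open>cancel\<close> and \<open>relation\<close> already allow arbitrary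
  surrounding words, so a further context is absorbed into theirs. This makes the relation a
  congruence for concatenation.\<close>

lemma pres_rel_context:
  "(u, v) \<in> pres_rel X Rel \<Longrightarrow> s \<in> words X \<Longrightarrow> t \<in> words X \<Longrightarrow>
    (s @ u @ t, s @ v @ t) \<in> pres_rel X Rel"
proof (induction rule: pres_rel.induct)
  case (cancel u v x b)
  then show ?case
    using pres_rel.cancel[of "s @ u" X "v @ t" x b Rel] by simp
next
  case (relation l r u v)
  then show ?case
    using pres_rel.relation[of l r Rel X "s @ u" "v @ t"] by simp
qed (auto intro: pres_rel.intros)

lemma pres_rel_append:
  assumes "(u, u') \<in> pres_rel X Rel" "(v, v') \<in> pres_rel X Rel"
  shows "(u @ v, u' @ v') \<in> pres_rel X Rel"
  using pres_rel_context[OF assms(1), of "[]" v] pres_rel_context[OF assms(2), of u' "[]"]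
    pres_rel_words[OF assms(1)] pres_rel_words[OF assms(2)]
  by (auto intro: pres_rel.trans)

abbreviation word_class :: "'a set \<Rightarrow> ('a word \<times> 'a word) set \<Rightarrow> 'a word \<Rightarrow> 'a word set" where
  "word_class X Rel w \<equiv> pres_rel X Rel `` {w}"

lemma word_class_eqI: "(u, v) \<in> pres_rel X Rel \<Longrightarrow> word_class X Rel u = word_class X Rel v"
  by (rule equiv_class_eq[OF equiv_pres_rel])

lemma carrier_presented_group: "carrier (presented_group X Rel) = word_class X Rel ` words X"
  by (auto simp: presented_group_def quotient_def)

lemma word_class_carrier [simp]:
  "w \<in> words X \<Longrightarrow> word_class X Rel w \<in> carrier (presented_group X Rel)"
  by (simp add: carrier_presented_group)

lemma one_presented_group: "\<one>\<^bsub>presented_group X Rel\<^esub> = word_class X Rel []"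
  by (simp add: presented_group_def)

lemma mult_presented_group:
  assumes "u \<in> words X" "v \<in> words X"
  shows "word_class X Rel u \<otimes>\<^bsub>presented_group X Rel\<^esub> word_class X Rel v = word_class X Rel (u @ v)"
proof -
  \<comment> \<open>By congruence all members of the double union coincide; \<open>u\<close> and
    \<open>v\<close> themselves show that the union is not empty.\<close>
  have "word_class X Rel (a @ b) = word_class X Rel (u @ v)"
    if "a \<in> word_class X Rel u" "b \<in> word_class X Rel v" for a b
    using that by (intro word_class_eqI pres_rel_append) (auto intro: pres_rel.sym)
  moreover have "u \<in> word_class X Rel u" "v \<in> word_class X Rel v"
    using assms by (auto intro: pres_rel.refl)
  ultimately show ?thesis
    unfolding presented_group_def monoid.simps by blast
qed

definition word_inv :: "'a word \<Rightarrow> 'a word" where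
  "word_inv w = rev (map (\<lambda>(b, x). (\<not> b, x)) w)"

lemma word_inv_words: "w \<in> words X \<Longrightarrow> word_inv w \<in> words X"
  by (induction w) (auto simp: word_inv_def)

lemma word_inv_cancel: "w \<in> words X \<Longrightarrow> (word_inv w @ w, []) \<in> pres_rel X Rel"
proof (induction w)
  case Nil
  then show ?case by (auto simp: word_inv_def intro: pres_rel.refl)
next
  case (Cons p w)
  obtain b x where p: "p = (b, x)" by (cases p)
  have w: "word_inv w \<in> words X" "w \<in> words X" "x \<in> X"
    using Cons.prems word_inv_words p by auto
  \<comment> \<open>The double negation is kept so that the rule \<open>cancel\<close> matches with
    \<open>\<not> b\<close> in place of \<open>b\<close>.\<close>
  have "(word_inv w @ [(\<not> b, x), (\<not> \<not> b, x)] @ w, word_inv w @ w) \<in> pres_rel X Rel"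
    using w by (intro pres_rel.cancel) auto
  then show ?case
    using Cons.IH w by (auto simp: p word_inv_def intro: pres_rel.trans)
qed

lemma group_presented_group: "group (presented_group X Rel)"
proof (rule groupI)
  fix g assume "g \<in> carrier (presented_group X Rel)"
  then obtain w where w: "w \<in> words X" "g = word_class X Rel w"
    by (auto simp: carrier_presented_group)
  have "word_class X Rel (word_inv w) \<otimes>\<^bsub>presented_group X Rel\<^esub> g = \<one>\<^bsub>presented_group X Rel\<^esub>"
    using w word_inv_cancel[of w X Rel]
    by (simp add: mult_presented_group one_presented_group word_inv_words word_class_eqI)
  then show "\<exists>y\<in>carrier (presented_group X Rel). y \<otimes>\<^bsub>presented_group X Rel\<^esub> g = \<one>\<^bsub>presented_group X Rel\<^esub>"
    using w word_inv_words word_class_carrier by metis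
qed (auto simp: carrier_presented_group mult_presented_group one_presented_group)

lemma generator_carrier [simp]:
  "x \<in> X \<Longrightarrow> generator X Rel x \<in> carrier (presented_group X Rel)"
  by (simp add: generator_def)

lemma presented_group_relation:
  assumes "(l, r) \<in> Rel" "l \<in> words X" "r \<in> words X"
  shows "word_class X Rel l = word_class X Rel r"
  using pres_rel.relation[OF assms, of "[]" "[]"] by (intro word_class_eqI) simp

text \<open>A letter \<open>x\<close> with sign \<open>False\<close> is removed by multiplying with
  the generator \<open>x\<close>, so descending from \<open>g x\<close> to \<open>g\<close> replaces
  a case for inverse generators. Later inductions then only have to understand multiplication by
  generators.\<close>

lemma presented_group_induct [consumes 1, case_names one mult cancel]:
  assumes "g \<in> carrier (presented_group X Rel)"
    and one: "P \<one>\<^bsub>presented_group X Rel\<^esub>"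
    and mult: "\<And>g x. g \<in> carrier (presented_group X Rel) \<Longrightarrow> x \<in> X \<Longrightarrow> P g \<Longrightarrow>
      P (g \<otimes>\<^bsub>presented_group X Rel\<^esub> generator X Rel x)"
    and cancel: "\<And>g x. g \<in> carrier (presented_group X Rel) \<Longrightarrow> x \<in> X \<Longrightarrow>
      P (g \<otimes>\<^bsub>presented_group X Rel\<^esub> generator X Rel x) \<Longrightarrow> P g"
  shows "P g"
proof -
  have "P (word_class X Rel w)" if "w \<in> words X" for w
    using that
  proof (induction w rule: rev_induct)
    case Nil
    then show ?case using one by (simp add: one_presented_group)
  next
    case (snoc p w)
    obtain b x where p: "p = (b, x)" by (cases p)
    have w: "w \<in> words X" "x \<in> X" "P (word_class X Rel w)"
      using snoc p by auto
    show ?case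
    proof (cases b)
      case True
      then show ?thesis
        using mult[of "word_class X Rel w" x] w
        by (simp add: p generator_def mult_presented_group)
    next
      case False
      have "(w @ [(False, x), (\<not> False, x)] @ [], w @ []) \<in> pres_rel X Rel"
        using w by (intro pres_rel.cancel) auto
      then show ?thesis
        using cancel[of "word_class X Rel (w @ [p])" x] w False word_class_eqI
        by (fastforce simp: p generator_def mult_presented_group)
    qed
  qed
  then show ?thesis
    using assms(1) by (auto simp: carrier_presented_group)
qed

lemma presented_group_hom_eqI:
  assumes "\<phi> \<in> hom (presented_group X Rel) H" "\<psi> \<in> hom (presented_group X Rel) H" "group H"
    and "\<And>x. x \<in> X \<Longrightarrow> \<phi> (generator X Rel x) = \<psi> (generator X Rel x)"
    and "g \<in> carrier (presented_group X Rel)"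
  shows "\<phi> g = \<psi> g"
proof -
  interpret G: group "presented_group X Rel" by (rule group_presented_group)
  interpret H: group H by fact
  interpret \<phi>: group_hom "presented_group X Rel" H \<phi>
    by unfold_locales fact
  interpret \<psi>: group_hom "presented_group X Rel" H \<psi>
    by unfold_locales fact
  show ?thesis
    using assms(5)
  proof (induction rule: presented_group_induct)
    case one
    show ?case by simp
  next
    case (mult g x)
    then show ?case by (simp add: assms(4))
  next
    case (cancel g x)
    then show ?case by (simp add: assms(4))
  qed
qed

section \<open>Evaluation of words and the universal property of a presentation\<close>

primrec word_eval :: "('b, 'c) monoid_scheme \<Rightarrow> ('a \<Rightarrow> 'b) \<Rightarrow> 'a word \<Rightarrow> 'b" where
  "word_eval H f [] = \<one>\<^bsub>H\<^esub>"
| "word_eval H f (p # w) =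
    (if fst p then f (snd p) else inv\<^bsub>H\<^esub> f (snd p)) \<otimes>\<^bsub>H\<^esub> word_eval H f w"

context group
begin

lemma word_eval_closed [simp]:
  "f \<in> X \<rightarrow> carrier G \<Longrightarrow> w \<in> words X \<Longrightarrow> word_eval G f w \<in> carrier G"
  by (induction w) (auto simp: Pi_iff)

lemma word_eval_append:
  "f \<in> X \<rightarrow> carrier G \<Longrightarrow> u \<in> words X \<Longrightarrow> v \<in> words X \<Longrightarrow>
    word_eval G f (u @ v) = word_eval G f u \<otimes> word_eval G f v"
proof (induction u)
  case (Cons p u)
  then have "f (snd p) \<in> carrier G"
    by (cases p) (auto simp: Pi_iff)
  with Cons show ?case
    by (cases p) (simp add: m_assoc)
qed simp

lemma word_eval_pres_rel:
  assumes f: "f \<in> X \<rightarrow> carrier G"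
    and rel: "\<And>l r. (l, r) \<in> Rel \<Longrightarrow> l \<in> words X \<Longrightarrow> r \<in> words X \<Longrightarrow>
      word_eval G f l = word_eval G f r"
    and "(u, v) \<in> pres_rel X Rel"
  shows "word_eval G f u = word_eval G f v"
  using assms(3)
proof (induction rule: pres_rel.induct)
  case (cancel u v x b)
  then have "f x \<in> carrier G" using f by auto
  with cancel have "word_eval G f ([(b, x), (\<not> b, x)] @ v) = word_eval G f v"
    using f by (cases b) (simp_all flip: m_assoc)
  with cancel show ?case
    using f by (simp add: word_eval_append[where X = X] del: word_eval.simps)
next
  case (relation l r u v)
  then show ?case
    using f rel[of l r] by (simp add: word_eval_append[where X = X])
qed auto

lemma presented_group_universal:
  assumes f: "f \<in> X \<rightarrow> carrier G"
    and rel: "\<And>l r. (l, r) \<in> Rel \<Longrightarrow> l \<in> words X \<Longrightarrow> r \<in> words X \<Longrightarrow>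
      word_eval G f l = word_eval G f r"
  obtains \<phi> where "\<phi> \<in> hom (presented_group X Rel) G"
    and "\<And>x. x \<in> X \<Longrightarrow> \<phi> (generator X Rel x) = f x"
proof
  \<comment> \<open>The choice of representative is harmless, since evaluation is constant on
    classes by \<open>word_eval_pres_rel\<close>.\<close>
  define \<phi> where "\<phi> C = word_eval G f (SOME w. w \<in> C)" for C
  have \<phi>: "\<phi> (word_class X Rel w) = word_eval G f w" if "w \<in> words X" for w
  proof -
    have "(w, SOME w'. w' \<in> word_class X Rel w) \<in> pres_rel X Rel"
      using someI[of "\<lambda>w'. w' \<in> word_class X Rel w" w] that by (auto intro: pres_rel.refl)
    then show ?thesis
      unfolding \<phi>_def using word_eval_pres_rel[OF f rel] by metis
  qed
  show "\<phi> \<in> hom (presented_group X Rel) G"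
    using f by (auto simp: hom_def carrier_presented_group mult_presented_group \<phi> word_eval_append)
  show "\<phi> (generator X Rel x) = f x" if "x \<in> X" for x
    using f that by (auto simp: generator_def \<phi> Pi_iff)
qed

end

section \<open>The affine group\<close>

lemma carrier_AutoGroup: "carrier (AutoGroup A) = auto A"
  by (simp add: AutoGroup_def)

lemma one_AutoGroup: "\<one>\<^bsub>AutoGroup A\<^esub> = (\<lambda>x\<in>carrier A. x)"
  by (simp add: AutoGroup_def BijGroup_def)

lemma mult_AutoGroup:
  "S \<in> auto A \<Longrightarrow> T \<in> auto A \<Longrightarrow> S \<otimes>\<^bsub>AutoGroup A\<^esub> T = compose (carrier A) S T"
  by (simp add: AutoGroup_def BijGroup_def auto_def)

lemma auto_closed: "S \<in> auto A \<Longrightarrow> a \<in> carrier A \<Longrightarrow> S a \<in> carrier A"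
  by (auto simp: auto_def hom_def)

lemma auto_mult:
  "S \<in> auto A \<Longrightarrow> a \<in> carrier A \<Longrightarrow> b \<in> carrier A \<Longrightarrow> S (a \<otimes>\<^bsub>A\<^esub> b) = S a \<otimes>\<^bsub>A\<^esub> S b"
  by (auto simp: auto_def hom_def)

lemma auto_comp:
  assumes "group A" "S \<in> auto A" "T \<in> auto A"
  shows "S \<otimes>\<^bsub>AutoGroup A\<^esub> T \<in> auto A"
proof -
  interpret group "AutoGroup A" using assms(1) by (rule group.AutoGroup)
  show ?thesis using assms m_closed by (simp add: carrier_AutoGroup)
qed

lemma carrier_Aff: "carrier (Aff A) = auto A \<times> carrier A"
  by (simp add: Aff_def carrier_AutoGroup)

lemma one_Aff: "\<one>\<^bsub>Aff A\<^esub> = (\<lambda>x\<in>carrier A. x, \<one>\<^bsub>A\<^esub>)"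
  by (simp add: Aff_def one_AutoGroup)

lemma mult_Aff: "p \<otimes>\<^bsub>Aff A\<^esub> q = (fst p \<otimes>\<^bsub>AutoGroup A\<^esub> fst q, snd p \<otimes>\<^bsub>A\<^esub> fst p (snd q))"
  by (simp add: Aff_def split_beta)

lemma (in group) group_Aff: "group (Aff G)"
proof -
  interpret Aut: group "AutoGroup G" by (rule AutoGroup)
  have id: "(\<lambda>x\<in>carrier G. x) \<in> auto G" by (rule id_in_auto)
  note simps = carrier_Aff one_Aff mult_Aff auto_comp auto_closed auto_mult group_axioms
  show ?thesis
  proof (rule groupI)
    fix p assume p: "p \<in> carrier (Aff G)"
    then have S: "fst p \<in> auto G" and a: "snd p \<in> carrier G"
      by (auto simp: carrier_Aff)
    define T where "T = inv\<^bsub>AutoGroup G\<^esub> fst p"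
    have T: "T \<in> auto G" "T \<otimes>\<^bsub>AutoGroup G\<^esub> fst p = \<one>\<^bsub>AutoGroup G\<^esub>"
      using S Aut.inv_closed[of "fst p"] Aut.l_inv[of "fst p"]
      by (auto simp: T_def carrier_AutoGroup)
    \<comment> \<open>As \<open>(T, b) (S, a) = (T S, b T(a))\<close>, the translation part of a
      left inverse must be the inverse of \<open>T a\<close>.\<close>
    then show "\<exists>q\<in>carrier (Aff G). q \<otimes>\<^bsub>Aff G\<^esub> p = \<one>\<^bsub>Aff G\<^esub>"
      using a by (intro bexI[of _ "(T, inv (T (snd p)))"]) (simp_all add: simps one_AutoGroup)
  next
    fix p q r assume "p \<in> carrier (Aff G)" "q \<in> carrier (Aff G)" "r \<in> carrier (Aff G)"
    then show "p \<otimes>\<^bsub>Aff G\<^esub> q \<otimes>\<^bsub>Aff G\<^esub> r = p \<otimes>\<^bsub>Aff G\<^esub> (q \<otimes>\<^bsub>Aff G\<^esub> r)"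
      using Aut.m_assoc[of "fst p" "fst q" "fst r"]
      by (auto simp: simps carrier_AutoGroup mult_AutoGroup compose_eq m_assoc)
  next
    fix p assume "p \<in> carrier (Aff G)"
    then show "\<one>\<^bsub>Aff G\<^esub> \<otimes>\<^bsub>Aff G\<^esub> p = p"
      using Aut.l_one[of "fst p"]
      by (auto simp: simps carrier_AutoGroup one_AutoGroup)
  qed (use id in \<open>auto simp: simps\<close>)
qed

lemma aff_apply_mult:
  assumes "group A" "p \<in> carrier (Aff A)" "q \<in> carrier (Aff A)" "b \<in> carrier A"
  shows "aff_apply A (p \<otimes>\<^bsub>Aff A\<^esub> q) b = aff_apply A p (aff_apply A q b)"
proof -
  interpret group A by fact
  show ?thesis
    using assms
    by (auto simp: aff_apply_def carrier_Aff mult_Aff mult_AutoGroup auto_closed auto_mult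
        compose_eq m_assoc)
qed

text \<open>An affine map is a permutation because its inverse in \<open>Aff G\<close> acts as its
  inverse map. Composing with this homomorphism turns an affine action into a group action on the
  carrier.\<close>

lemma (in group) aff_apply_hom: "aff_apply G \<in> hom (Aff G) (BijGroup (carrier G))"
proof -
  interpret Aff: group "Aff G" by (rule group_Aff)
  have closed: "aff_apply G p b \<in> carrier G" if "p \<in> carrier (Aff G)" "b \<in> carrier G" for p b
    using that by (auto simp: aff_apply_def carrier_Aff auto_closed)
  have one: "aff_apply G \<one>\<^bsub>Aff G\<^esub> b = b" if "b \<in> carrier G" for b
    using that by (simp add: aff_apply_def one_Aff)
  have bij: "aff_apply G p \<in> Bij (carrier G)" if p: "p \<in> carrier (Aff G)" for p
    unfolding Bij_def
  proof (intro IntI CollectI)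
    show "aff_apply G p \<in> extensional (carrier G)"
      by (simp add: aff_apply_def split_beta)
    show "bij_betw (aff_apply G p) (carrier G) (carrier G)"
    proof (rule bij_betw_byWitness[where f' = "aff_apply G (inv\<^bsub>Aff G\<^esub> p)"])
      show "\<forall>b\<in>carrier G. aff_apply G (inv\<^bsub>Aff G\<^esub> p) (aff_apply G p b) = b"
        "\<forall>b\<in>carrier G. aff_apply G p (aff_apply G (inv\<^bsub>Aff G\<^esub> p) b) = b"
        using p by (simp_all add: one group_axioms flip: aff_apply_mult)
    qed (simp_all add: image_subset_iff closed p)
  qed
  show ?thesis
  proof (rule homI)
    fix p q assume pq: "p \<in> carrier (Aff G)" "q \<in> carrier (Aff G)"
    show "aff_apply G (p \<otimes>\<^bsub>Aff G\<^esub> q) =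
        aff_apply G p \<otimes>\<^bsub>BijGroup (carrier G)\<^esub> aff_apply G q"
    proof (rule extensionalityI[of _ "carrier G"])
      show "aff_apply G (p \<otimes>\<^bsub>Aff G\<^esub> q) \<in> extensional (carrier G)"
        using pq bij Bij_imp_extensional Aff.m_closed by blast
    qed (use pq bij in \<open>auto simp: BijGroup_def aff_apply_mult group_axioms compose_eq\<close>)
  qed (simp add: bij BijGroup_def)
qed

section \<open>Braid identities and the diagonal map\<close>

locale ybe =
  fixes X :: "'a set" and R :: "'a \<times> 'a \<Rightarrow> 'a \<times> 'a"
  assumes solution: "YBE_solution X R"
begin

abbreviation \<alpha> where "\<alpha> \<equiv> alpha R"
abbreviation \<beta> where "\<beta> \<equiv> beta R"
abbreviation G where "G \<equiv> structure_group X R"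
abbreviation A where "A \<equiv> derived_structure_group X R"
abbreviation s where "s \<equiv> structure_gen X R"
abbreviation d where "d \<equiv> derived_gen X R"

lemma bij_alpha: "x \<in> X \<Longrightarrow> bij_betw (\<alpha> x) X X"
  using solution by (simp add: YBE_solution_def)

lemma bij_beta: "x \<in> X \<Longrightarrow> bij_betw (\<beta> x) X X"
  using solution by (simp add: YBE_solution_def)

lemma alpha_closed [simp]: "x \<in> X \<Longrightarrow> y \<in> X \<Longrightarrow> \<alpha> x y \<in> X"
  by (rule bij_betw_apply[OF bij_alpha])

lemma beta_closed [simp]: "x \<in> X \<Longrightarrow> y \<in> X \<Longrightarrow> \<beta> x y \<in> X"
  by (rule bij_betw_apply[OF bij_beta])

lemma alpha_cancel: "x \<in> X \<Longrightarrow> y \<in> X \<Longrightarrow> z \<in> X \<Longrightarrow> \<alpha> x y = \<alpha> x z \<longleftrightarrow> y = z"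
  by (rule inj_on_eq_iff[OF bij_betw_imp_inj_on[OF bij_alpha]])

lemma beta_cancel: "x \<in> X \<Longrightarrow> y \<in> X \<Longrightarrow> z \<in> X \<Longrightarrow> \<beta> x y = \<beta> x z \<longleftrightarrow> y = z"
  by (rule inj_on_eq_iff[OF bij_betw_imp_inj_on[OF bij_beta]])

lemma alpha_surj: "x \<in> X \<Longrightarrow> y \<in> X \<Longrightarrow> \<exists>z\<in>X. \<alpha> x z = y"
  using bij_betw_imp_surj_on[OF bij_alpha, of x] by (metis imageE)

lemma beta_surj: "x \<in> X \<Longrightarrow> y \<in> X \<Longrightarrow> \<exists>z\<in>X. \<beta> x z = y"
  using bij_betw_imp_surj_on[OF bij_beta, of x] by (metis imageE)

text \<open>These are the first and the middle coordinates of the braid equation at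
  \<open>(x, y, z)\<close>.\<close>

lemma braid:
  assumes "x \<in> X" "y \<in> X" "z \<in> X"
  shows braid_alpha: "\<alpha> (\<alpha> x y) (\<alpha> (\<beta> y x) z) = \<alpha> x (\<alpha> y z)"
    and braid_mixed: "\<beta> (\<alpha> (\<beta> y x) z) (\<alpha> x y) = \<alpha> (\<beta> (\<alpha> y z) x) (\<beta> z y)"
proof -
  have R: "R (u, v) = (\<alpha> u v, \<beta> v u)" for u v
    by (simp add: alpha_def beta_def)
  have "(R_times_id R \<circ> id_times_R R \<circ> R_times_id R) (x, y, z) =
      (id_times_R R \<circ> R_times_id R \<circ> id_times_R R) (x, y, z)"
    using solution assms unfolding YBE_solution_def by blast
  then show "\<alpha> (\<alpha> x y) (\<alpha> (\<beta> y x) z) = \<alpha> x (\<alpha> y z)"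
    "\<beta> (\<alpha> (\<beta> y x) z) (\<alpha> x y) = \<alpha> (\<beta> (\<alpha> y z) x) (\<beta> z y)"
    by (simp_all add: R R_times_id_def id_times_R_def)
qed

text \<open>With \<open>\<alpha> y z = y\<close>, both sides of \<open>braid_alpha\<close> begin
  with \<open>\<alpha> y\<close>, which cancels.\<close>

lemma alpha_eq_if_fixed:
  assumes "y \<in> X" "z \<in> X" "\<alpha> y z = y" "x \<in> X"
  shows "\<alpha> (\<beta> z y) x = \<alpha> z x"
  using braid_alpha[OF assms(1,2,4)] assms by (simp add: alpha_cancel)

text \<open>
  In the skew brace on the structure group, \<open>\<alpha> y z = y\<close> says that \<open>z\<close> is the additive inverse
  of \<open>y\<inverse>\<close>; so \<open>y\<close> is a function of \<open>z\<close>, namely \<open>\<alpha> w z\<close> with \<open>\<beta> z w = z\<close>.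
\<close>

lemma diagonal_unique:
  assumes y: "y \<in> X" and z: "z \<in> X" and fixed: "\<alpha> y z = y" and w: "w \<in> X" "\<beta> z w = z"
  shows "y = \<alpha> w z"
proof -
  \<comment> \<open>This \<open>c\<close> makes \<open>braid_mixed\<close> express both
    \<open>\<beta> z (\<alpha> w z)\<close> and \<open>\<beta> z y\<close> as
    \<open>\<alpha> z (\<beta> c z)\<close>; then \<open>\<beta> z\<close> is cancelled.\<close>
  obtain c where c: "c \<in> X" "\<alpha> z c = z"
    using alpha_surj z by blast
  have "\<beta> (\<alpha> (\<beta> z w) c) (\<alpha> w z) = \<alpha> (\<beta> (\<alpha> z c) w) (\<beta> c z)"
    using braid_mixed w z c by blast
  then have 1: "\<beta> z (\<alpha> w z) = \<alpha> z (\<beta> c z)"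
    using c w by simp
  have "\<beta> (\<alpha> (\<beta> z y) c) (\<alpha> y z) = \<alpha> (\<beta> (\<alpha> z c) y) (\<beta> c z)"
    using braid_mixed y z c by blast
  then have 2: "\<beta> z y = \<alpha> z (\<beta> c z)"
    using c z y fixed by (simp add: alpha_eq_if_fixed)
  show ?thesis
    using beta_cancel[of z y "\<alpha> w z"] 1 2 w y z by simp
qed

text \<open>The value \<open>\<alpha> w z\<close> forced by \<open>diagonal_unique\<close> does
  work: apply \<open>braid_alpha\<close> to \<open>w\<close>, \<open>z\<close>, \<open>t\<close>
  with \<open>\<alpha> z t = z\<close>. This is surjectivity of the diagonal map.\<close>

lemma diagonal_exists:
  assumes "z \<in> X"
  shows "\<exists>y\<in>X. \<alpha> y z = y"
proof -
  obtain w where w: "w \<in> X" "\<beta> z w = z"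
    using beta_surj assms by blast
  have "\<alpha> (\<alpha> w z) z = \<alpha> w z"
  proof -
    obtain t where "t \<in> X" "\<alpha> z t = z"
      using alpha_surj assms by blast
    then show ?thesis
      using braid_alpha[of w z t] w assms by simp
  qed
  then show ?thesis
    using w assms by (intro bexI[of _ "\<alpha> w z"]) simp_all
qed

text \<open>Both elements equal \<open>\<alpha> w z\<close> for one and the same
  \<open>w\<close>.\<close>

lemma diagonal_inj:
  assumes "y \<in> X" "y' \<in> X" "z \<in> X" "\<alpha> y z = y" "\<alpha> y' z = y'"
  shows "y = y'"
proof -
  obtain w where "w \<in> X" "\<beta> z w = z"
    using beta_surj assms(3) by blast
  then show ?thesis
    using diagonal_unique[of y z w] diagonal_unique[of y' z w] assms by simp
qed

section \<open>The structure groups and the associated action\<close>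

lemma group_G: "group G"
  by (simp add: structure_group_def group_presented_group)

lemma group_A: "group A"
  by (simp add: derived_structure_group_def group_presented_group)

sublocale G: group G by (rule group_G)
sublocale A: group A by (rule group_A)

lemma s_closed [simp]: "x \<in> X \<Longrightarrow> s x \<in> carrier G"
  by (simp add: structure_group_def structure_gen_def)

lemma d_closed [simp]: "x \<in> X \<Longrightarrow> d x \<in> carrier A"
  by (simp add: derived_structure_group_def derived_gen_def)

lemma s_relation:
  assumes "x \<in> X" "y \<in> X"
  shows "s x \<otimes>\<^bsub>G\<^esub> s y = s (\<alpha> x y) \<otimes>\<^bsub>G\<^esub> s (\<beta> y x)"
proof -
  have "([(True, x), (True, y)], [(True, \<alpha> x y), (True, \<beta> y x)]) \<in> structure_relations X R"
    using assms by (auto simp: structure_relations_def)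
  from presented_group_relation[OF this, of X] show ?thesis
    using assms
    by (simp add: structure_group_def structure_gen_def generator_def mult_presented_group)
qed

text \<open>The substitution \<open>y = \<alpha> x z\<close> removes the inverse of
  \<open>\<alpha> x\<close> from the defining relation and makes the braid identities
  applicable.\<close>

lemma d_relation:
  assumes "x \<in> X" "z \<in> X"
  shows "d x \<otimes>\<^bsub>A\<^esub> d (\<alpha> x z) = d (\<alpha> x z) \<otimes>\<^bsub>A\<^esub> d (\<alpha> (\<alpha> x z) (\<beta> z x))"
proof -
  have "inv_into X (\<alpha> x) (\<alpha> x z) = z"
    using assms bij_alpha by (simp add: bij_betw_def)
  then have "([(True, x), (True, \<alpha> x z)], [(True, \<alpha> x z), (True, \<alpha> (\<alpha> x z) (\<beta> z x))])
      \<in> derived_relations X R"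
    using assms unfolding derived_relations_def by (intro CollectI exI[of _ x] exI[of _ "\<alpha> x z"]) simp
  from presented_group_relation[OF this, of X] show ?thesis
    using assms
    by (simp add: derived_structure_group_def derived_gen_def generator_def mult_presented_group)
qed

section \<open>Universal properties and induction for the two groups\<close>

lemma structure_group_universal:
  assumes "group H" and f: "f \<in> X \<rightarrow> carrier H"
    and rel: "\<And>x y. x \<in> X \<Longrightarrow> y \<in> X \<Longrightarrow> f x \<otimes>\<^bsub>H\<^esub> f y = f (\<alpha> x y) \<otimes>\<^bsub>H\<^esub> f (\<beta> y x)"
  obtains \<phi> where "\<phi> \<in> hom G H" and "\<And>x. x \<in> X \<Longrightarrow> \<phi> (s x) = f x"
proof -
  interpret H: group H by fact
  have "word_eval H f l = word_eval H f r" if "(l, r) \<in> structure_relations X R" for l r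
  proof -
    obtain x y where xy: "x \<in> X" "y \<in> X" "l = [(True, x), (True, y)]"
      "r = [(True, \<alpha> x y), (True, \<beta> y x)]"
      using \<open>(l, r) \<in> structure_relations X R\<close> by (auto simp: structure_relations_def)
    with rel[of x y] f show ?thesis
      by (simp add: Pi_iff)
  qed
  then obtain \<phi> where "\<phi> \<in> hom G H" "\<And>x. x \<in> X \<Longrightarrow> \<phi> (s x) = f x"
    using H.presented_group_universal[OF f, of "structure_relations X R"]
    unfolding structure_group_def structure_gen_def by metis
  then show thesis ..
qed

lemma derived_structure_group_universal:
  assumes "group H" and f: "f \<in> X \<rightarrow> carrier H"
    and rel: "\<And>x z. x \<in> X \<Longrightarrow> z \<in> X \<Longrightarrow>
      f x \<otimes>\<^bsub>H\<^esub> f (\<alpha> x z) = f (\<alpha> x z) \<otimes>\<^bsub>H\<^esub> f (\<alpha> (\<alpha> x z) (\<beta> z x))"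
  obtains \<phi> where "\<phi> \<in> hom A H" and "\<And>x. x \<in> X \<Longrightarrow> \<phi> (d x) = f x"
proof -
  interpret H: group H by fact
  have "word_eval H f l = word_eval H f r" if "(l, r) \<in> derived_relations X R" for l r
  proof -
    obtain x y where xy: "x \<in> X" "y \<in> X" "l = [(True, x), (True, y)]"
      "r = [(True, y), (True, \<alpha> y (\<beta> (inv_into X (\<alpha> x) y) x))]"
      using \<open>(l, r) \<in> derived_relations X R\<close> by (auto simp: derived_relations_def)
    define z where "z = inv_into X (\<alpha> x) y"
    have "z \<in> X" "\<alpha> x z = y"
      using xy bij_alpha by (auto simp: z_def bij_betw_def inv_into_into f_inv_into_f)
    with xy rel[of x z] f show ?thesis
      by (auto simp: z_def Pi_iff)
  qed
  then obtain \<phi> where "\<phi> \<in> hom A H" "\<And>x. x \<in> X \<Longrightarrow> \<phi> (d x) = f x"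
    using H.presented_group_universal[OF f, of "derived_relations X R"]
    unfolding derived_structure_group_def derived_gen_def by metis
  then show thesis ..
qed

lemmas structure_group_induct [consumes 1, case_names one mult cancel] =
  presented_group_induct[of _ X "structure_relations X R",
    folded structure_group_def structure_gen_def]

lemmas derived_structure_group_induct [consumes 1, case_names one mult cancel] =
  presented_group_induct[of _ X "derived_relations X R",
    folded derived_structure_group_def derived_gen_def]

lemmas derived_structure_group_hom_eqI =
  presented_group_hom_eqI[of _ X "derived_relations X R",
    folded derived_structure_group_def derived_gen_def]

text \<open>The pair \<open>(x, z)\<close> indexes a relation of \<open>A\<close>;
  \<open>\<alpha> w\<close> carries it to the relation indexed by \<open>(x', z')\<close>. The
  second claim uses \<open>braid_alpha\<close> at \<open>w\<close>, \<open>\<alpha> x z\<close>,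
  \<open>\<beta> z x\<close> and then \<open>braid_mixed\<close> at \<open>w\<close>,
  \<open>x\<close>, \<open>z\<close>.\<close>

lemma alpha_equivariant:
  assumes "w \<in> X" "x \<in> X" "z \<in> X"
  defines "x' \<equiv> \<alpha> w x" and "z' \<equiv> \<alpha> (\<beta> x w) z"
  shows "\<alpha> w (\<alpha> x z) = \<alpha> x' z'"
    and "\<alpha> w (\<alpha> (\<alpha> x z) (\<beta> z x)) = \<alpha> (\<alpha> x' z') (\<beta> z' x')"
proof -
  show 1: "\<alpha> w (\<alpha> x z) = \<alpha> x' z'"
    using assms by (simp add: braid_alpha)
  have "\<alpha> w (\<alpha> (\<alpha> x z) (\<beta> z x)) = \<alpha> (\<alpha> w (\<alpha> x z)) (\<alpha> (\<beta> (\<alpha> x z) w) (\<beta> z x))"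
    using assms by (simp add: braid_alpha)
  then show "\<alpha> w (\<alpha> (\<alpha> x z) (\<beta> z x)) = \<alpha> (\<alpha> x' z') (\<beta> z' x')"
    using assms 1 by (simp add: braid_mixed)
qed

section \<open>Automorphisms of the derived group and the affine action\<close>

lemma auto_eqI:
  assumes "S \<in> auto A" "T \<in> auto A" "\<And>y. y \<in> X \<Longrightarrow> S (d y) = T (d y)"
  shows "S = T"
  using assms derived_structure_group_hom_eqI[of S A T, OF _ _ group_A]
  by (intro extensionalityI[of S "carrier A" T]) (auto simp: auto_def Bij_def)

lemma derived_automorphism_exists:
  assumes w: "w \<in> X"
  shows "\<exists>S\<in>auto A. \<forall>y\<in>X. S (d y) = d (\<alpha> w y)"
proof -
  have "d (\<alpha> w x) \<otimes>\<^bsub>A\<^esub> d (\<alpha> w (\<alpha> x z)) =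
      d (\<alpha> w (\<alpha> x z)) \<otimes>\<^bsub>A\<^esub> d (\<alpha> w (\<alpha> (\<alpha> x z) (\<beta> z x)))"
    if "x \<in> X" "z \<in> X" for x z
    using d_relation[of "\<alpha> w x" "\<alpha> (\<beta> x w) z"] w that
    by (simp add: alpha_equivariant[OF w that])
  from derived_structure_group_universal[where f = "\<lambda>y. d (\<alpha> w y)", OF group_A _ this]
  obtain \<phi> where \<phi>: "\<phi> \<in> hom A A" "\<And>y. y \<in> X \<Longrightarrow> \<phi> (d y) = d (\<alpha> w y)"
    using w by (auto simp: Pi_iff)
  define \<gamma> where "\<gamma> = inv_into X (\<alpha> w)"
  have \<gamma>: "\<gamma> (\<alpha> w y) = y" "\<gamma> y \<in> X" "\<alpha> w (\<gamma> y) = y" if "y \<in> X" for y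
    using that bij_alpha[OF w] bij_betw_inv_into[OF bij_alpha[OF w]]
    by (simp_all add: \<gamma>_def bij_betw_inv_into_left bij_betw_inv_into_right bij_betw_apply)
  \<comment> \<open>The inverse permutation respects the relations too: every index
    \<open>(x', z')\<close> comes from some \<open>(x, z)\<close>, as \<open>\<alpha> w\<close> and
    \<open>\<alpha> (\<beta> x w)\<close> are onto.\<close>
  have "d (\<gamma> x') \<otimes>\<^bsub>A\<^esub> d (\<gamma> (\<alpha> x' z')) =
      d (\<gamma> (\<alpha> x' z')) \<otimes>\<^bsub>A\<^esub> d (\<gamma> (\<alpha> (\<alpha> x' z') (\<beta> z' x')))"
    if x'z': "x' \<in> X" "z' \<in> X" for x' z'
  proof -
    obtain x where x: "x \<in> X" "\<alpha> w x = x'"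
      using alpha_surj[OF w x'z'(1)] by blast
    obtain z where z: "z \<in> X" "\<alpha> (\<beta> x w) z = z'"
      using alpha_surj[OF beta_closed[OF x(1) w] x'z'(2)] by blast
    note eq = alpha_equivariant[OF w x(1) z(1), unfolded x(2) z(2)]
    have "\<gamma> x' = x" "\<gamma> (\<alpha> x' z') = \<alpha> x z"
      "\<gamma> (\<alpha> (\<alpha> x' z') (\<beta> z' x')) = \<alpha> (\<alpha> x z) (\<beta> z x)"
      using \<gamma>(1)[of x] \<gamma>(1)[of "\<alpha> x z"] \<gamma>(1)[of "\<alpha> (\<alpha> x z) (\<beta> z x)"] x z(1)
      by (simp_all add: eq)
    then show ?thesis
      by (simp only: d_relation[OF x(1) z(1)])
  qed
  from derived_structure_group_universal[where f = "\<lambda>y. d (\<gamma> y)", OF group_A _ this]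
  obtain \<psi> where \<psi>: "\<psi> \<in> hom A A" "\<And>y. y \<in> X \<Longrightarrow> \<psi> (d y) = d (\<gamma> y)"
    using \<gamma>(2) by (auto simp: Pi_iff)
  have closed: "\<phi> a \<in> carrier A" "\<psi> a \<in> carrier A" if "a \<in> carrier A" for a
    using \<phi>(1) \<psi>(1) that by (auto simp: hom_def)
  have id: "(\<lambda>a. a) \<in> hom A A" by (simp add: hom_def)
  have inverse: "\<psi> (\<phi> a) = a" "\<phi> (\<psi> a) = a" if "a \<in> carrier A" for a
    using derived_structure_group_hom_eqI[OF A.hom_compose[OF \<phi>(1) \<psi>(1)] id group_A _ that]
      derived_structure_group_hom_eqI[OF A.hom_compose[OF \<psi>(1) \<phi>(1)] id group_A _ that]
      that \<phi>(2) \<psi>(2) \<gamma> w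
    by (simp_all add: compose_eq)
  have "bij_betw \<phi> (carrier A) (carrier A)"
    using inverse closed by (intro bij_betw_byWitness[where f' = \<psi>]) auto
  then have "restrict \<phi> (carrier A) \<in> auto A"
    using \<phi>(1) by (auto simp: auto_def Bij_def hom_def)
  then show ?thesis
    using \<phi>(2) by (intro bexI[of _ "restrict \<phi> (carrier A)"]) simp_all
qed

lemma associated_affine_action_exists: "\<exists>\<rho>. associated_affine_action X R \<rho>"
proof -
  obtain L where L: "\<And>x. x \<in> X \<Longrightarrow> L x \<in> auto A"
    "\<And>x y. x \<in> X \<Longrightarrow> y \<in> X \<Longrightarrow> L x (d y) = d (\<alpha> x y)"
    using derived_automorphism_exists by metis
  have group_Aff: "group (Aff A)" by (rule A.group_Aff)
  have rel: "L x \<otimes>\<^bsub>AutoGroup A\<^esub> L y = L (\<alpha> x y) \<otimes>\<^bsub>AutoGroup A\<^esub> L (\<beta> y x)"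
    if "x \<in> X" "y \<in> X" for x y
  proof (rule auto_eqI)
    show "L x \<otimes>\<^bsub>AutoGroup A\<^esub> L y \<in> auto A" "L (\<alpha> x y) \<otimes>\<^bsub>AutoGroup A\<^esub> L (\<beta> y x) \<in> auto A"
      using that L(1) by (simp_all add: auto_comp group_A)
  qed (use that L in \<open>simp add: mult_AutoGroup compose_eq braid_alpha\<close>)
  \<comment> \<open>The linear parts agree by \<open>rel\<close>; the translation parts are exactly
    the two sides of \<open>d_relation\<close>.\<close>
  have "(L x, d x) \<otimes>\<^bsub>Aff A\<^esub> (L y, d y) =
      (L (\<alpha> x y), d (\<alpha> x y)) \<otimes>\<^bsub>Aff A\<^esub> (L (\<beta> y x), d (\<beta> y x))"
    if "x \<in> X" "y \<in> X" for x y
    using that L(2) rel[OF that] d_relation[OF that] by (simp add: mult_Aff)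
  from structure_group_universal[where f = "\<lambda>x. (L x, d x)", OF group_Aff _ this]
  obtain \<rho> where \<rho>: "\<rho> \<in> hom G (Aff A)" "\<And>x. x \<in> X \<Longrightarrow> \<rho> (s x) = (L x, d x)"
    using L(1) by (auto simp: carrier_Aff Pi_iff)
  have "group_hom G (Aff A) \<rho>"
    using group_G group_Aff \<rho>(1) by (simp add: group_hom_def group_hom_axioms_def)
  then show ?thesis
    using \<rho>(2) L group_A unfolding associated_affine_action_def affine_action_def by auto
qed

section \<open>Regularity\<close>

lemma generator_action_exists:
  "\<exists>\<theta>\<in>hom G (BijGroup X). \<forall>x\<in>X. \<forall>y\<in>X. \<theta> (s x) y = \<alpha> x y"
proof -
  define f where "f x = restrict (\<alpha> x) X" for x
  have f: "f x \<in> Bij X" if "x \<in> X" for x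
    using that bij_alpha by (simp add: f_def Bij_def)
  have "f x \<otimes>\<^bsub>BijGroup X\<^esub> f y = f (\<alpha> x y) \<otimes>\<^bsub>BijGroup X\<^esub> f (\<beta> y x)" if "x \<in> X" "y \<in> X" for x y
    using that f
    by (intro extensionalityI[of _ X]) (auto simp: BijGroup_def compose_eq f_def braid_alpha)
  from structure_group_universal[OF group_BijGroup _ this]
  obtain \<theta> where "\<theta> \<in> hom G (BijGroup X)" "\<And>x. x \<in> X \<Longrightarrow> \<theta> (s x) = f x"
    using f by (auto simp: BijGroup_def)
  then show ?thesis
    by (auto simp: f_def intro!: bexI[of _ \<theta>])
qed

text \<open>The affine map of \<open>g\<close> sends the unit of \<open>A\<close> to
  \<open>snd (\<rho> g)\<close>, so this is regularity seen from the orbit of the unit.\<close>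

lemma cocycle_bij:
  assumes assoc: "associated_affine_action X R \<rho>"
  shows "bij_betw (\<lambda>g. snd (\<rho> g)) (carrier G) (carrier A)"
proof -
  define \<pi> where "\<pi> g = snd (\<rho> g)" for g
  define L where "L g = fst (\<rho> g)" for g
  have group_Aff: "group (Aff A)" by (rule A.group_Aff)
  interpret \<rho>: group_hom G "Aff A" \<rho>
    using assoc by (simp add: associated_affine_action_def affine_action_def)
  have gens: "\<pi> (s x) = d x" "L (s x) (d y) = d (\<alpha> x y)" if "x \<in> X" "y \<in> X" for x y
    using assoc that by (auto simp: associated_affine_action_def \<pi>_def L_def)
  have closed [simp]: "L g \<in> auto A" "\<pi> g \<in> carrier A" if "g \<in> carrier G" for g
    using \<rho>.hom_closed[OF that] by (auto simp: carrier_Aff L_def \<pi>_def)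
  have \<pi>_one: "\<pi> \<one>\<^bsub>G\<^esub> = \<one>\<^bsub>A\<^esub>" and L_one: "L \<one>\<^bsub>G\<^esub> = (\<lambda>a\<in>carrier A. a)"
    using \<rho>.hom_one by (simp_all add: \<pi>_def L_def one_Aff)
  have \<pi>_mult: "\<pi> (g \<otimes>\<^bsub>G\<^esub> h) = \<pi> g \<otimes>\<^bsub>A\<^esub> L g (\<pi> h)"
    and L_mult: "L (g \<otimes>\<^bsub>G\<^esub> h) = compose (carrier A) (L g) (L h)"
    if "g \<in> carrier G" "h \<in> carrier G" for g h
    using that closed[of g] closed[of h] \<rho>.hom_mult[of g h]
    by (simp_all add: \<pi>_def L_def mult_Aff mult_AutoGroup)

  obtain \<theta> where \<theta>: "\<theta> \<in> hom G (BijGroup X)" and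
    \<theta>_gen: "\<And>x y. x \<in> X \<Longrightarrow> y \<in> X \<Longrightarrow> \<theta> (s x) y = \<alpha> x y"
    using generator_action_exists by blast
  interpret \<theta>: group_action G X \<theta>
    using \<theta> group_G group_BijGroup by (simp add: group_action_def group_hom_def group_hom_axioms_def)
  have \<theta>_closed [simp]: "\<theta> g x \<in> X" if "g \<in> carrier G" "x \<in> X" for g x
    using \<theta>.element_image that by blast
  have \<theta>_inv [simp]: "\<theta> g (\<theta> (inv\<^bsub>G\<^esub> g) x) = x" "\<theta> (inv\<^bsub>G\<^esub> g) (\<theta> g x) = x"
    if "g \<in> carrier G" "x \<in> X" for g x
    using that \<theta>.orbit_sym_aux[of g x] \<theta>.orbit_sym_aux[of "inv\<^bsub>G\<^esub> g" x] by auto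
  \<comment> \<open>This extends \<open>alpha_equivariant\<close> from generators to all of
    \<open>G\<close>: each \<open>\<theta> g\<close> permutes the relations of
    \<open>A\<close>.\<close>
  have equivariant: "\<exists>t\<in>X. \<theta> g (\<alpha> x z) = \<alpha> (\<theta> g x) t \<and>
      \<theta> g (\<alpha> (\<alpha> x z) (\<beta> z x)) = \<alpha> (\<alpha> (\<theta> g x) t) (\<beta> t (\<theta> g x))"
    if "g \<in> carrier G" "x \<in> X" "z \<in> X" for g x z
    using that
  proof (induction arbitrary: x z rule: structure_group_induct)
    case one
    then show ?case by (auto simp flip: \<theta>.id_eq_one)
  next
    case (mult g w)
    then show ?case
      using mult.IH[of "\<alpha> w x" "\<alpha> (\<beta> x w) z"]
      by (simp add: \<theta>_gen \<theta>.composition_rule alpha_equivariant[of w x z])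
  next
    case (cancel g w)
    \<comment> \<open>The index \<open>(x, z)\<close> is pulled back along
      \<open>\<alpha> w\<close>, so that the hypothesis for \<open>g\<close> times
      \<open>s w\<close> applies.\<close>
    obtain x' where x': "x' \<in> X" "\<alpha> w x' = x"
      using alpha_surj[of w x] cancel by blast
    obtain z' where z': "z' \<in> X" "\<alpha> (\<beta> x' w) z' = z"
      using alpha_surj[OF beta_closed[OF x'(1) cancel(2)], of z] cancel by blast
    show ?case
      using cancel.IH[of x' z'] cancel(1,2) x' z'
      by (simp add: \<theta>_gen \<theta>.composition_rule alpha_equivariant[of w x' z'])
  qed
  have L_\<theta>: "L g (d y) = d (\<theta> g y)" if "g \<in> carrier G" "y \<in> X" for g y
    using that
  proof (induction arbitrary: y rule: structure_group_induct)
    case one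
    then show ?case by (simp add: L_one flip: \<theta>.id_eq_one)
  next
    case (mult g x)
    then show ?case
      by (simp add: L_mult compose_eq gens \<theta>_gen \<theta>.composition_rule)
  next
    case (cancel g x)
    obtain z where "z \<in> X" "\<alpha> x z = y"
      using alpha_surj[of x y] cancel by blast
    then show ?case
      using cancel(3)[of z] cancel(1,2)
      by (simp add: L_mult compose_eq gens \<theta>_gen \<theta>.composition_rule)
  qed

  \<comment> \<open>The appended generator is twisted by the inverse of \<open>g\<close> so that
    \<open>L g\<close> in the cocycle identity undoes the twist, leaving right multiplication by
    \<open>d x\<close> in \<open>\<pi>_\<Phi>\<close>.\<close>
  define \<Phi> where "\<Phi> x g = g \<otimes>\<^bsub>G\<^esub> s (\<theta> (inv\<^bsub>G\<^esub> g) x)" for x g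
  have \<Phi>_closed [simp]: "\<Phi> x g \<in> carrier G" if "x \<in> X" "g \<in> carrier G" for x g
    using that by (simp add: \<Phi>_def)
  have \<pi>_\<Phi>: "\<pi> (\<Phi> x g) = \<pi> g \<otimes>\<^bsub>A\<^esub> d x" if "x \<in> X" "g \<in> carrier G" for x g
    using that by (simp add: \<Phi>_def \<pi>_mult gens L_\<theta>)
  \<comment> \<open>Conversely, right multiplication by \<open>s y\<close> at \<open>g\<close> is a
    lift whose index depends on \<open>g\<close>; inductions over \<open>G\<close> can thus be run
    through \<open>\<Phi>\<close>.\<close>
  have \<Phi>_\<theta>: "\<Phi> (\<theta> g y) g = g \<otimes>\<^bsub>G\<^esub> s y" if "y \<in> X" "g \<in> carrier G" for y g
    using that by (simp add: \<Phi>_def)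

  have diagonal: "\<alpha> (\<theta> (inv\<^bsub>G\<^esub> g) x) (\<theta> (inv\<^bsub>G\<^esub> \<Phi> x g) x) = \<theta> (inv\<^bsub>G\<^esub> g) x"
    if "x \<in> X" "g \<in> carrier G" for x g
  proof -
    define p where "p = \<theta> (inv\<^bsub>G\<^esub> g) x"
    have p: "p \<in> X" "\<theta> g p = x" using that by (simp_all add: p_def)
    \<comment> \<open>Since \<open>\<Phi> x g\<close> is \<open>g\<close> times \<open>s p\<close>,
      the image \<open>\<Phi> x g\<close> alone determines the value of the diagonal map at
      \<open>p\<close>.\<close>
    have "\<theta> (inv\<^bsub>G\<^esub> \<Phi> x g) x = \<theta> (inv\<^bsub>G\<^esub> s p) p"
      using that p by (simp add: \<Phi>_def G.inv_mult_group \<theta>.composition_rule flip: p_def)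
    then have "\<alpha> p (\<theta> (inv\<^bsub>G\<^esub> \<Phi> x g) x) = p"
      using p by (simp flip: \<theta>_gen)
    then show ?thesis by (simp add: p_def)
  qed
  have \<Phi>_inj: "g = h"
    if "x \<in> X" "g \<in> carrier G" "h \<in> carrier G" "\<Phi> x g = \<Phi> x h" for x g h
  proof -
    have "\<theta> (inv\<^bsub>G\<^esub> g) x = \<theta> (inv\<^bsub>G\<^esub> h) x"
      by (rule diagonal_inj[of _ _ "\<theta> (inv\<^bsub>G\<^esub> \<Phi> x g) x"])
        (use diagonal[of x g] diagonal[of x h] that in simp_all)
    then show ?thesis
      using that by (simp add: \<Phi>_def)
  qed
  have \<Phi>_surj: "\<exists>g\<in>carrier G. \<Phi> x g = k" if xk: "x \<in> X" "k \<in> carrier G" for x k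
  proof -
    \<comment> \<open>By \<open>diagonal\<close>, a preimage of \<open>k\<close> must end in a step
      \<open>s p\<close> with this \<open>p\<close>; stripping it from \<open>k\<close> gives
      \<open>g\<close>.\<close>
    obtain p where p: "p \<in> X" "\<alpha> p (\<theta> (inv\<^bsub>G\<^esub> k) x) = p"
      using diagonal_exists[of "\<theta> (inv\<^bsub>G\<^esub> k) x"] xk by auto
    define g where "g = k \<otimes>\<^bsub>G\<^esub> inv\<^bsub>G\<^esub> s p"
    have g: "g \<in> carrier G" using that p by (simp add: g_def)
    have "\<theta> (inv\<^bsub>G\<^esub> g) x = p"
      using that p by (simp add: g_def G.inv_mult_group \<theta>.composition_rule \<theta>_gen)
    then have "\<Phi> x g = k"
      using that p by (simp add: \<Phi>_def g_def G.m_assoc)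
    with g show ?thesis by blast
  qed

  \<comment> \<open>The lifts satisfy the relations of the derived group\<close>
  define F where "F x = restrict (\<Phi> x) (carrier G)" for x
  have F: "F x \<in> carrier (BijGroup (carrier G))" if "x \<in> X" for x
  proof -
    have "bij_betw (\<Phi> x) (carrier G) (carrier G)"
      unfolding bij_betw_def
    proof
      show "inj_on (\<Phi> x) (carrier G)"
        by (rule inj_onI) (rule \<Phi>_inj[OF that])
      show "\<Phi> x ` carrier G = carrier G"
        using \<Phi>_closed[OF that] \<Phi>_surj[OF that] by blast
    qed
    then show ?thesis
      by (simp add: F_def BijGroup_def Bij_def)
  qed
  interpret B: group "BijGroup (carrier G)" by (rule group_BijGroup)
  have F_mult: "(F x \<otimes>\<^bsub>BijGroup (carrier G)\<^esub> F y) g = \<Phi> x (\<Phi> y g)"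
    if "x \<in> X" "y \<in> X" "g \<in> carrier G" for x y g
    using that F[of x] F[of y] by (simp add: BijGroup_def compose_eq) (simp add: F_def)
  have F_rel: "F (\<alpha> x z) \<otimes>\<^bsub>BijGroup (carrier G)\<^esub> F x =
      F (\<alpha> (\<alpha> x z) (\<beta> z x)) \<otimes>\<^bsub>BijGroup (carrier G)\<^esub> F (\<alpha> x z)"
    if xz: "x \<in> X" "z \<in> X" for x z
  proof (rule extensionalityI[of _ "carrier G"])
    fix g assume g: "g \<in> carrier G"
    define p where "p = \<theta> (inv\<^bsub>G\<^esub> g) x"
    define q where "q = \<theta> (inv\<^bsub>G\<^esub> g) (\<alpha> x z)"
    obtain t where t: "t \<in> X" "q = \<alpha> p t"
      "\<theta> (inv\<^bsub>G\<^esub> g) (\<alpha> (\<alpha> x z) (\<beta> z x)) = \<alpha> q (\<beta> t p)"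
      using equivariant[of "inv\<^bsub>G\<^esub> g" x z] g xz by (auto simp: p_def q_def)
    have pq: "p \<in> X" "q \<in> X" using g xz by (simp_all add: p_def q_def)
    \<comment> \<open>After the first lift the base point is \<open>g\<close> times
      \<open>s w\<close>, whose inverse moves \<open>v\<close> to the preimage of
      \<open>\<alpha> w y\<close> under \<open>\<alpha> w\<close>, which is
      \<open>y\<close>.\<close>
    have step: "\<Phi> v (\<Phi> u g) = g \<otimes>\<^bsub>G\<^esub> (s w \<otimes>\<^bsub>G\<^esub> s y)"
      if "u \<in> X" "v \<in> X" "w \<in> X" "y \<in> X" "\<theta> (inv\<^bsub>G\<^esub> g) u = w" "\<theta> (inv\<^bsub>G\<^esub> g) v = \<alpha> w y"
      for u v w y
    proof -
      have "\<theta> (inv\<^bsub>G\<^esub> (g \<otimes>\<^bsub>G\<^esub> s w)) v = y"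
        using that g \<theta>_inv(2)[of "s w" y]
        by (simp add: G.inv_mult_group \<theta>.composition_rule \<theta>_gen)
      then show ?thesis
        using that g by (simp add: \<Phi>_def G.m_assoc)
    qed
    have "\<Phi> (\<alpha> x z) (\<Phi> x g) = g \<otimes>\<^bsub>G\<^esub> (s p \<otimes>\<^bsub>G\<^esub> s t)"
      by (rule step) (use xz pq t in \<open>simp_all add: p_def q_def\<close>)
    \<comment> \<open>Seen from \<open>g\<close>, the relation of \<open>A\<close> indexed by
      \<open>(x, z)\<close> becomes the relation of \<open>G\<close> for
      \<open>(p, t)\<close>.\<close>
    also have "s p \<otimes>\<^bsub>G\<^esub> s t = s q \<otimes>\<^bsub>G\<^esub> s (\<beta> t p)"
      using s_relation[of p t] pq t by simp
    also have "g \<otimes>\<^bsub>G\<^esub> (s q \<otimes>\<^bsub>G\<^esub> s (\<beta> t p)) = \<Phi> (\<alpha> (\<alpha> x z) (\<beta> z x)) (\<Phi> (\<alpha> x z) g)"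
      by (rule step[symmetric]) (use xz pq t in \<open>simp_all add: q_def\<close>)
    finally show "(F (\<alpha> x z) \<otimes>\<^bsub>BijGroup (carrier G)\<^esub> F x) g =
        (F (\<alpha> (\<alpha> x z) (\<beta> z x)) \<otimes>\<^bsub>BijGroup (carrier G)\<^esub> F (\<alpha> x z)) g"
      using xz g by (simp add: F_mult)
  qed (use xz F in \<open>simp_all add: BijGroup_def\<close>)

  txt \<open>The lifts of right multiplications compose in reverse order, so their inverses are used.\<close>
  define F' where "F' x = inv\<^bsub>BijGroup (carrier G)\<^esub> F x" for x
  have "F' x \<otimes>\<^bsub>BijGroup (carrier G)\<^esub> F' (\<alpha> x z) =
      F' (\<alpha> x z) \<otimes>\<^bsub>BijGroup (carrier G)\<^esub> F' (\<alpha> (\<alpha> x z) (\<beta> z x))"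
    if "x \<in> X" "z \<in> X" for x z
    using F_rel[OF that] that F by (simp add: F'_def flip: B.inv_mult_group)
  from derived_structure_group_universal[OF group_BijGroup _ this]
  obtain \<Psi> where \<Psi>: "\<Psi> \<in> hom A (BijGroup (carrier G))" and
    \<Psi>_gen: "\<And>x. x \<in> X \<Longrightarrow> \<Psi> (d x) = F' x"
    using F by (auto simp: F'_def)
  interpret \<Psi>: group_hom A "BijGroup (carrier G)" \<Psi>
    by unfold_locales (rule \<Psi>)
  interpret \<Psi>': group_action A "carrier G" \<Psi>
    by unfold_locales (rule \<Psi>)
  \<comment> \<open>As \<open>\<Psi>\<close> sends \<open>d x\<close> to the inverse of
    \<open>F x\<close>, inverting \<open>a\<close> makes \<open>\<kappa> a\<close> the result of
    lifting right multiplication by \<open>a\<close> and applying it to the unit of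
    \<open>G\<close>.\<close>
  define \<kappa> where "\<kappa> a = \<Psi> (inv\<^bsub>A\<^esub> a) \<one>\<^bsub>G\<^esub>" for a
  have \<kappa>_closed [simp]: "\<kappa> a \<in> carrier G" if "a \<in> carrier A" for a
    using that \<Psi>'.element_image[of "inv\<^bsub>A\<^esub> a" "\<one>\<^bsub>G\<^esub>"] by (simp add: \<kappa>_def)
  have \<kappa>_one: "\<kappa> \<one>\<^bsub>A\<^esub> = \<one>\<^bsub>G\<^esub>"
    by (simp add: \<kappa>_def BijGroup_def)
  have \<kappa>_mult: "\<kappa> (a \<otimes>\<^bsub>A\<^esub> d x) = \<Phi> x (\<kappa> a)" if "a \<in> carrier A" "x \<in> X" for a x
  proof -
    have "\<Psi> (inv\<^bsub>A\<^esub> d x) = F x"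
      using that F by (simp add: \<Psi>_gen F'_def)
    then have "\<kappa> (a \<otimes>\<^bsub>A\<^esub> d x) = F x (\<kappa> a)"
      using that by (simp add: \<kappa>_def A.inv_mult_group \<Psi>'.composition_rule del: \<Psi>.hom_inv \<Psi>.hom_mult)
    then show ?thesis
      using that by (simp add: F_def)
  qed

  \<comment> \<open>The cocycle and the orbit map are mutually inverse\<close>
  have "\<kappa> (\<pi> g) = g" if "g \<in> carrier G" for g
    using that
  proof (induction rule: structure_group_induct)
    case one
    show ?case by (simp add: \<pi>_one \<kappa>_one)
  next
    case (mult g x)
    then show ?case by (simp add: \<pi>_\<Phi> \<kappa>_mult flip: \<Phi>_\<theta>)
  next
    case (cancel g x)
    then have "\<Phi> (\<theta> g x) (\<kappa> (\<pi> g)) = \<Phi> (\<theta> g x) g"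
      by (simp add: \<pi>_\<Phi> \<kappa>_mult flip: \<Phi>_\<theta>)
    \<comment> \<open>Descending from \<open>g\<close> times \<open>s x\<close> to \<open>g\<close>
      needs injectivity of the lift; in \<open>A\<close> the generator simply cancels.\<close>
    with cancel show ?case
      using \<Phi>_inj[of "\<theta> g x" "\<kappa> (\<pi> g)" g] by simp
  qed
  moreover have "\<pi> (\<kappa> a) = a" if "a \<in> carrier A" for a
    using that
  proof (induction rule: derived_structure_group_induct)
    case one
    show ?case by (simp add: \<pi>_one \<kappa>_one)
  next
    case (mult a x)
    then show ?case by (simp add: \<pi>_\<Phi> \<kappa>_mult)
  next
    case (cancel a x)
    then show ?case by (simp add: \<pi>_\<Phi> \<kappa>_mult)
  qed
  ultimately show ?thesis
    unfolding \<pi>_def[symmetric] by (intro bij_betw_byWitness[where f' = \<kappa>]) auto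
qed

text \<open>By \<open>orbit\<close>, the cocycle intertwines left multiplication on \<open>G\<close>
  with the affine action. Being bijective, it transports the regularity of left
  multiplication.\<close>

lemma associated_affine_action_regular:
  assumes assoc: "associated_affine_action X R \<rho>"
  shows "regular_affine_action G A \<rho>"
proof -
  have affine: "affine_action G A \<rho>"
    using assoc by (simp add: associated_affine_action_def)
  interpret \<rho>: group_hom G "Aff A" \<rho>
    using affine by (simp add: affine_action_def)
  have bij: "bij_betw (\<lambda>g. snd (\<rho> g)) (carrier G) (carrier A)"
    by (rule cocycle_bij[OF assoc])
  have orbit: "aff_apply A (\<rho> g) (snd (\<rho> h)) = snd (\<rho> (g \<otimes>\<^bsub>G\<^esub> h))"
    if "g \<in> carrier G" "h \<in> carrier G" for g h
    using that \<rho>.hom_closed[of h] by (auto simp: aff_apply_def mult_Aff split_beta carrier_Aff)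
  have preimage: "\<exists>h\<in>carrier G. snd (\<rho> h) = a" if "a \<in> carrier A" for a
    using bij_betw_imp_surj_on[OF bij] that by (metis imageE)
  have "(\<lambda>g. aff_apply A (\<rho> g)) \<in> hom G (BijGroup (carrier A))"
    by (rule homI) (simp_all add: hom_in_carrier[OF A.aff_apply_hom] hom_mult[OF A.aff_apply_hom])
  then have "group_action G (carrier A) (\<lambda>g. aff_apply A (\<rho> g))"
    using group_G group_BijGroup by (simp add: group_action_def group_hom_def group_hom_axioms_def)
  moreover have "\<exists>g\<in>carrier G. aff_apply A (\<rho> g) a = b" if ab: "a \<in> carrier A" "b \<in> carrier A" for a b
  proof -
    obtain h k where hk: "h \<in> carrier G" "snd (\<rho> h) = a" "k \<in> carrier G" "snd (\<rho> k) = b"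
      using preimage ab by metis
    then show ?thesis
      using orbit[of "k \<otimes>\<^bsub>G\<^esub> inv\<^bsub>G\<^esub> h" h]
      by (intro bexI[of _ "k \<otimes>\<^bsub>G\<^esub> inv\<^bsub>G\<^esub> h"]) (simp_all add: G.m_assoc)
  qed
  ultimately have "transitive_action G (carrier A) (\<lambda>g. aff_apply A (\<rho> g))"
    by (simp add: transitive_action_def transitive_action_axioms_def)
  moreover have "stabilizer G (\<lambda>g. aff_apply A (\<rho> g)) a = {\<one>\<^bsub>G\<^esub>}" if a: "a \<in> carrier A" for a
  proof -
    obtain h where h: "h \<in> carrier G" "snd (\<rho> h) = a"
      using preimage a by blast
    \<comment> \<open>Fixing \<open>a\<close> means that \<open>g h\<close> and \<open>h\<close>
      have the same cocycle value, hence are equal.\<close>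
    have "aff_apply A (\<rho> g) a = a \<longleftrightarrow> g = \<one>\<^bsub>G\<^esub>" if "g \<in> carrier G" for g
      using that h(1) orbit[of g h, unfolded h(2)]
        inj_on_eq_iff[OF bij_betw_imp_inj_on[OF bij], of "g \<otimes>\<^bsub>G\<^esub> h" h]
      by (simp add: h(2))
    then show ?thesis
      by (auto simp: stabilizer_def)
  qed
  ultimately show ?thesis
    using affine by (simp add: regular_affine_action_def)
qed

end

theorem proposition2p5:
  fixes X :: "'a set" and R :: "'a \<times> 'a \<Rightarrow> 'a \<times> 'a"
  assumes "YBE_solution X R"
  shows "\<exists>\<rho>. associated_affine_action X R \<rho> \<and>
    regular_affine_action (structure_group X R) (derived_structure_group X R) \<rho>"
proof -
  interpret ybe X R
    using assms by unfold_locales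
  show ?thesis
    using associated_affine_action_exists associated_affine_action_regular by blast
qed

end
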